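(* Let $d\ge 1$ and $t\in\mathbb{N}$. Let $\mathcal{P}\subseteq\mathbb{R}^{d+1}$ be a full-dimensional convex polytope, centered at the origin, which is edge-transitive. If its symmetry group $G=\{g\in\mathcal{O}(d+1): g\mathcal{P}=\mathcal{P}\}$ is $t$-homogeneous, then every Euler cycle of the edge graph of $\mathcal{P}$, projected onto the sphere $\mathbb{S}^d$, is a spherical $t$-design cycle.
   Context: $\mathbb{S}^d=\{x\in\mathbb{R}^{d+1}:\|x\|=1\}$. $\int_{\mathbb{S}^d}p$ is the integral with respect to the normalized (probability) orthogonally invariant measure on $\mathbb{S}^d$. $\mathrm{Pol}_{\le t}$ is the space of real polynomials of total degree at most $t$ in $d+1$ variables, restricted to $\mathbb{S}^d$. A finite subgroup $G\subseteq\mathcal{O}(d+1)$ of the orthogonal group is $t$-homogeneous if for every $x_0\in\mathbb{S}^d$ the orbit $X=Gx_0=\{gx_0:g\in G\}$ is a spherical $t$-design, i.e. $\frac{1}{|X|}\sum_{x\in X}p(x)=\int_{\mathbb{S}^d}p$ for all $p\in\mathrm{Pol}_{\le t}$. The convex polytope $\mathcal{P}$ (convex hull of finitely many points) is edge-transitive if its symmetry group acts transitively on its edges ($1$-dimensional faces). The polytope is centered at the origin, in particular the origin lies in its interior, so that no edge contains the origin and radial outward projection $x\mapsto x/\|x\|$ maps each edge onto a geodesic arc on $\mathbb{S}^d$. The vertices and edges of $\mathcal{P}$ form a graph; an Euler cycle is a closed walk in this graph traversing every edge exactly once. Projecting the edges of an Euler cycle onto the sphere, in the order of the cycle, gives a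 geodesic cycle. For $x,y\in\mathbb{S}^d$, $y\neq\pm x$, the geodesic arc $\gamma_{x,y}$ is the unit-speed shortest great-circle arc from $x$ to $y$, of length $\mathrm{dist}(x,y)=\arccos\langle x,y\rangle$. A geodesic cycle $\gamma$ is a closed chain of finitely many geodesic arcs $\gamma_{x_0,x_1},\gamma_{x_1,x_2},\dots,\gamma_{x_n,x_0}$; $\int_\gamma p$ is the sum of the arc-length integrals of $p$ over these arcs and $\ell(\gamma)=\int_\gamma 1$ is its length. It is a spherical $t$-design cycle if $\frac{1}{\ell(\gamma)}\int_\gamma p=\int_{\mathbb{S}^d}p$ for all $p\in\mathrm{Pol}_{\le t}$. *)

theory Defs
  imports "HOL-Analysis.Analysis" "HOL-Algebra.Group"
begin

text \<open>The space \<open>real ^ 'n\<close> plays the role of R^(d+1), with \<open>CARD('n) = d + 1\<close>,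
  and S^d is \<open>sphere 0 1\<close>.\<close>

text \<open>A real function on \<open>real ^ 'n\<close> is used here to represent its restriction to the sphere.
  The index \<open>\<alpha>\<close> is the exponent vector of a monomial.\<close>

definition Pol_le :: "nat \<Rightarrow> (real ^ 'n \<Rightarrow> real) set" where
  "Pol_le t = {p. \<exists>c. p = (\<lambda>x. \<Sum>\<alpha> | (\<Sum>i\<in>UNIV. \<alpha> i) \<le> t. c \<alpha> * (\<Prod>i\<in>UNIV. (x $ i) ^ \<alpha> i))}"

definition radial_proj :: "real ^ 'n \<Rightarrow> real ^ 'n" where
  "radial_proj x = x /\<^sub>R norm x"

text \<open>The normalized rotation invariant measure, obtained by projecting the uniform distribution
  on the unit ball radially. It is a measure on the Borel sets of the whole space, concentrated
  on the sphere; the lemmas below check its characteristic properties.\<close>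

definition sphere_measure :: "(real ^ 'n) measure" where
  "sphere_measure = distr (uniform_measure lborel (ball 0 1)) borel radial_proj"

definition sphere_integral :: "(real ^ 'n \<Rightarrow> real) \<Rightarrow> real" where
  "sphere_integral p = (\<integral>x. p x \<partial>sphere_measure)"

definition spherical_design :: "nat \<Rightarrow> (real ^ 'n) set \<Rightarrow> bool" where
  "spherical_design t X \<longleftrightarrow>
     finite X \<and> X \<noteq> {} \<and> X \<subseteq> sphere 0 1 \<and>
     (\<forall>p\<in>Pol_le t. (\<Sum>x\<in>X. p x) / card X = sphere_integral p)"

definition orthogonal_group :: "(real ^ 'n \<Rightarrow> real ^ 'n) monoid" where
  "orthogonal_group = \<lparr>carrier = {g. orthogonal_transformation g}, mult = (\<circ>), one = id\<rparr>"

definition homogeneous :: "nat \<Rightarrow> (real ^ 'n \<Rightarrow> real ^ 'n) set \<Rightarrow> bool" where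
  "homogeneous t G \<longleftrightarrow>
     finite G \<and> subgroup G orthogonal_group \<and>
     (\<forall>x\<^sub>0\<in>sphere 0 1. spherical_design t {g x\<^sub>0 | g. g \<in> G})"

definition symmetry_group :: "(real ^ 'n) set \<Rightarrow> (real ^ 'n \<Rightarrow> real ^ 'n) set" where
  "symmetry_group P = {g \<in> carrier orthogonal_group. g ` P = P}"

definition edge_transitive :: "(real ^ 'n) set \<Rightarrow> bool" where
  "edge_transitive P \<longleftrightarrow>
     (\<forall>e f. e edge_of P \<longrightarrow> f edge_of P \<longrightarrow> (\<exists>g\<in>symmetry_group P. g ` e = f))"

text \<open>Closed walks and closed chains of arcs are lists without repetition of the starting point:
  \<open>[x\<^sub>0, \<dots>, x\<^sub>n]\<close> stands for \<open>x\<^sub>0, \<dots>, x\<^sub>n, x\<^sub>0\<close>.\<close>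

definition cyclic_pairs :: "'a list \<Rightarrow> ('a \<times> 'a) list" where
  "cyclic_pairs xs = zip xs (rotate1 xs)"

text \<open>An edge of a polytope is the segment between its two vertices, so the edges traversed by a walk
  are the segments between consecutive vertices; that they are edges of \<open>P\<close> is part of the last
  condition.\<close>

definition euler_cycle :: "(real ^ 'n) set \<Rightarrow> (real ^ 'n) list \<Rightarrow> bool" where
  "euler_cycle P vs \<longleftrightarrow>
     vs \<noteq> [] \<and> (\<forall>v\<in>set vs. v extreme_point_of P) \<and>
     (let es = map (\<lambda>(u, v). closed_segment u v) (cyclic_pairs vs)
      in distinct es \<and> set es = {e. e edge_of P})"

definition geodesic_dist :: "real ^ 'n \<Rightarrow> real ^ 'n \<Rightarrow> real" where
  "geodesic_dist x y = arccos (x \<bullet> y)"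

text \<open>The unit-speed parametrization on \<open>{0..geodesic_dist x y}\<close>; the initial velocity is the
  normalized component of \<open>y\<close> orthogonal to \<open>x\<close>.\<close>

definition geodesic_arc :: "real ^ 'n \<Rightarrow> real ^ 'n \<Rightarrow> real \<Rightarrow> real ^ 'n" where
  "geodesic_arc x y s = cos s *\<^sub>R x + sin s *\<^sub>R radial_proj (y - (x \<bullet> y) *\<^sub>R x)"

definition geodesic_cycle :: "(real ^ 'n) list \<Rightarrow> bool" where
  "geodesic_cycle xs \<longleftrightarrow>
     xs \<noteq> [] \<and> set xs \<subseteq> sphere 0 1 \<and> (\<forall>(x, y)\<in>set (cyclic_pairs xs). y \<noteq> x \<and> y \<noteq> - x)"

definition cycle_integral :: "(real ^ 'n) list \<Rightarrow> (real ^ 'n \<Rightarrow> real) \<Rightarrow> real" where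
  "cycle_integral xs p =
     (\<Sum>(x, y)\<leftarrow>cyclic_pairs xs. integral {0..geodesic_dist x y} (\<lambda>s. p (geodesic_arc x y s)))"

definition cycle_length :: "(real ^ 'n) list \<Rightarrow> real" where
  "cycle_length xs = cycle_integral xs (\<lambda>_. 1)"

definition spherical_design_cycle :: "nat \<Rightarrow> (real ^ 'n) list \<Rightarrow> bool" where
  "spherical_design_cycle t xs \<longleftrightarrow>
     geodesic_cycle xs \<and>
     (\<forall>p\<in>Pol_le t. cycle_integral xs p / cycle_length xs = sphere_integral p)"


subsection \<open>Consistency of the definitions with the intended notions\<close>

lemma group_orthogonal_group: "Group.group (orthogonal_group :: (real ^ 'n \<Rightarrow> real ^ 'n) monoid)"
proof (rule groupI)
  fix f :: "real ^ 'n \<Rightarrow> real ^ 'n" assume "f \<in> carrier orthogonal_group"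
  then have f: "orthogonal_transformation f" by (simp add: orthogonal_group_def)
  have "inv_into UNIV f \<circ> f = id"
    using orthogonal_transformation_inj[OF f] by (simp add: inv_o_cancel)
  moreover have "orthogonal_transformation (inv_into UNIV f)" using f by (rule orthogonal_transformation_inv)
  ultimately show "\<exists>g\<in>carrier orthogonal_group. g \<otimes>\<^bsub>orthogonal_group\<^esub> f = \<one>\<^bsub>orthogonal_group\<^esub>"
    by (auto simp: orthogonal_group_def)
qed (auto simp: orthogonal_group_def orthogonal_transformation_compose orthogonal_transformation_id
      id_def comp_assoc)

lemma norm_radial_proj: "x \<noteq> 0 \<Longrightarrow> norm (radial_proj x) = 1"
  by (simp add: radial_proj_def)

lemma radial_proj_measurable [measurable]: "radial_proj \<in> borel_measurable borel"
  unfolding radial_proj_def by measurable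

lemma radial_proj_orthogonal:
  assumes "orthogonal_transformation g"
  shows "radial_proj (g x) = g (radial_proj x)"
  using assms orthogonal_transformation_norm[OF assms, of x]
  by (simp add: radial_proj_def linear_scale orthogonal_transformation_linear)

lemma emeasure_unit_ball:
  "emeasure lborel (ball 0 1 :: (real ^ 'n) set) \<noteq> 0"
  "emeasure lborel (ball 0 1 :: (real ^ 'n) set) \<noteq> \<infinity>"
  using unit_ball_vol_pos[of "real CARD('n)"] by (simp_all add: emeasure_ball del: unit_ball_vol_pos)

lemma sets_sphere_measure [simp]: "sets sphere_measure = sets borel"
  by (simp add: sphere_measure_def)

lemma space_sphere_measure [simp]: "space sphere_measure = UNIV"
  by (simp add: sphere_measure_def)

lemma emeasure_sphere_measure:
  fixes A :: "(real ^ 'n) set"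
  assumes "A \<in> sets borel"
  shows "emeasure sphere_measure A =
    emeasure lborel (ball 0 1 \<inter> radial_proj -` A) / emeasure lborel (ball 0 1 :: (real ^ 'n) set)"
proof -
  have "radial_proj -` A \<in> sets borel"
    using measurable_sets[OF radial_proj_measurable assms] by simp
  then show ?thesis using assms
    by (simp add: sphere_measure_def emeasure_distr)
qed

lemma emeasure_sphere_measure_sphere:
  "emeasure sphere_measure (sphere 0 1 :: (real ^ 'n) set) = 1"
proof -
  have "ball 0 1 \<inter> radial_proj -` sphere 0 1 = ball 0 1 - {0 :: real ^ 'n}"
    by (auto simp: norm_radial_proj) (simp add: radial_proj_def)
  moreover have "emeasure lborel (ball 0 1 - {0 :: real ^ 'n}) = emeasure lborel (ball 0 1 :: (real ^ 'n) set)"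
    by (rule emeasure_Diff_null_set) auto
  ultimately show ?thesis
    using emeasure_unit_ball[where 'n='n] by (simp add: emeasure_sphere_measure ennreal_divide_self less_top)
qed

lemma emeasure_sphere_measure_UNIV:
  "emeasure sphere_measure (UNIV :: (real ^ 'n) set) = 1"
  using emeasure_unit_ball[where 'n='n] by (simp add: emeasure_sphere_measure ennreal_divide_self less_top)

lemma distr_orthogonal_lborel:
  fixes g :: "'a::euclidean_space \<Rightarrow> 'a"
  assumes g: "orthogonal_transformation g"
  shows "distr lborel borel g = lborel"
proof (rule measure_eqI)
  fix A :: "'a set" assume "A \<in> sets (distr lborel borel g)"
  then have A [measurable]: "A \<in> sets borel" by simp
  have lin: "linear g" using g by (rule orthogonal_transformation_linear)
  have gm [measurable]: "g \<in> borel_measurable borel"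
    by (intro borel_measurable_continuous_onI linear_continuous_on lin
        linear_conv_bounded_linear[THEN iffD1])
  let ?\<mu> = "distr lborel borel g"
  let ?B = "ball 0 1 :: 'a set"
  have B [measurable]: "?B \<in> sets borel" by simp
  have lb_shift: "(\<integral>\<^sup>+x. f (c + x) \<partial>lborel) = (\<integral>\<^sup>+x. f x \<partial>lborel)"
    if [measurable]: "f \<in> borel_measurable borel" for f :: "'a \<Rightarrow> ennreal" and c
    by (subst (2) lborel_distr_plus[symmetric, of c]) (simp add: nn_integral_distr)
  have mu_int: "(\<integral>\<^sup>+x. f x \<partial>?\<mu>) = (\<integral>\<^sup>+x. f (g x) \<partial>lborel)"
    if [measurable]: "f \<in> borel_measurable borel" for f :: "'a \<Rightarrow> ennreal"
    by (simp add: nn_integral_distr)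
  have mu_shift: "(\<integral>\<^sup>+x. f (c + g x) \<partial>lborel) = (\<integral>\<^sup>+x. f (g x) \<partial>lborel)"
    if [measurable]: "f \<in> borel_measurable borel" for f :: "'a \<Rightarrow> ennreal" and c
  proof -
    obtain c' where "c = g c'" using orthogonal_transformation_surj[OF g] by auto
    then show ?thesis
      using lb_shift[of "\<lambda>x. f (g x)" c'] by (simp add: linear_add[OF lin])
  qed
  have gB: "indicator ?B (- g x) = (indicator ?B x :: ennreal)" for x
    using orthogonal_transformation_norm[OF g] by (simp add: indicator_def)
  have "emeasure ?\<mu> A * emeasure lborel ?B
      = (\<integral>\<^sup>+x. indicator A (g x) * (\<integral>\<^sup>+y. indicator ?B y \<partial>lborel) \<partial>lborel)"
    using mu_int[of "indicator A"] by (simp add: nn_integral_multc)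
  also have "\<dots> = (\<integral>\<^sup>+x. indicator A (g x) * (\<integral>\<^sup>+y. indicator ?B (- g x + y) \<partial>lborel) \<partial>lborel)"
    using lb_shift[of "indicator ?B"] by (simp del: add_uminus_conv_diff uminus_add_conv_diff)
  also have "\<dots> = (\<integral>\<^sup>+x. (\<integral>\<^sup>+y. indicator A (g x) * indicator ?B (- g x + y) \<partial>lborel) \<partial>lborel)"
    by (simp add: nn_integral_cmult)
  also have "\<dots> = (\<integral>\<^sup>+y. (\<integral>\<^sup>+x. indicator A (g x) * indicator ?B (- g x + y) \<partial>lborel) \<partial>lborel)"
    by (rule lborel_pair.Fubini'[symmetric]) measurable
  also have "\<dots> = (\<integral>\<^sup>+y. (\<integral>\<^sup>+x. indicator A (y + g x) * indicator ?B (- g x) \<partial>lborel) \<partial>lborel)"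
  proof (rule nn_integral_cong)
    fix y
    show "(\<integral>\<^sup>+x. indicator A (g x) * indicator ?B (- g x + y) \<partial>lborel)
        = (\<integral>\<^sup>+x. indicator A (y + g x) * indicator ?B (- g x) \<partial>lborel)"
      using mu_shift[of "\<lambda>z. indicator A z * indicator ?B (- z + y)" y] by simp
  qed
  also have "\<dots> = (\<integral>\<^sup>+x. (\<integral>\<^sup>+y. indicator A (y + g x) * indicator ?B x \<partial>lborel) \<partial>lborel)"
    unfolding gB by (rule lborel_pair.Fubini') measurable
  also have "\<dots> = (\<integral>\<^sup>+x. (\<integral>\<^sup>+y. indicator A (g x + y) \<partial>lborel) * indicator ?B x \<partial>lborel)"
    by (simp add: nn_integral_multc add.commute)
  also have "\<dots> = emeasure lborel A * emeasure lborel ?B"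
    by (subst lb_shift) (auto simp: nn_integral_cmult)
  finally have "emeasure ?\<mu> A * emeasure lborel ?B = emeasure lborel A * emeasure lborel ?B" .
  moreover have "emeasure lborel ?B \<noteq> 0" "emeasure lborel ?B \<noteq> \<infinity>"
    using unit_ball_vol_pos[of "real DIM('a)"] by (simp_all add: emeasure_ball del: unit_ball_vol_pos)
  ultimately show "emeasure ?\<mu> A = emeasure lborel A"
    by (metis ennreal_mult_cancel_left mult.commute infinity_ennreal_def)
qed simp

lemma sphere_measure_invariant:
  fixes g :: "real ^ 'n \<Rightarrow> real ^ 'n"
  assumes g: "orthogonal_transformation g"
  shows "distr sphere_measure borel g = sphere_measure"
proof (rule measure_eqI)
  fix A :: "(real ^ 'n) set" assume "A \<in> sets (distr sphere_measure borel g)"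
  then have A: "A \<in> sets borel" by simp
  have gm: "g \<in> borel_measurable borel"
    by (intro borel_measurable_continuous_onI linear_continuous_on
        linear_conv_bounded_linear[THEN iffD1] orthogonal_transformation_linear g)
  have gm': "g \<in> borel_measurable sphere_measure"
    using gm by (simp add: sphere_measure_def)
  let ?B = "ball 0 1 \<inter> radial_proj -` A"
  have gA: "g -` A \<in> sets borel" using measurable_sets[OF gm A] by simp
  have pb: "radial_proj -` C \<in> sets borel" if "C \<in> sets borel" for C :: "(real ^ 'n) set"
    using measurable_sets[OF radial_proj_measurable that] by simp
  have eq: "g ` (ball 0 1 \<inter> radial_proj -` (g -` A)) = ?B"
  proof
    show "g ` (ball 0 1 \<inter> radial_proj -` (g -` A)) \<subseteq> ?B"
      using g by (auto simp: radial_proj_orthogonal orthogonal_transformation_norm)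
    show "?B \<subseteq> g ` (ball 0 1 \<inter> radial_proj -` (g -` A))"
    proof
      fix y assume y: "y \<in> ?B"
      obtain x where "y = g x" using orthogonal_transformation_surj[OF g] by auto
      with y g show "y \<in> g ` (ball 0 1 \<inter> radial_proj -` (g -` A))"
        by (auto simp: radial_proj_orthogonal orthogonal_transformation_norm)
    qed
  qed
  have "emeasure lborel ?B = emeasure (distr lborel borel g) ?B"
    using distr_orthogonal_lborel[OF g] by simp
  also have "\<dots> = emeasure lborel (g -` ?B)"
    using gm pb[OF A] by (subst emeasure_distr) auto
  also have "g -` ?B = ball 0 1 \<inter> radial_proj -` (g -` A)"
    using orthogonal_transformation_inj[OF g] by (subst eq[symmetric], intro inj_vimage_image_eq)
  finally have "emeasure lborel ?B = emeasure lborel (ball 0 1 \<inter> radial_proj -` (g -` A))" .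
  then show "emeasure (distr sphere_measure borel g) A = emeasure sphere_measure A"
    using A gA gm' by (simp add: emeasure_distr emeasure_sphere_measure)
qed simp

text \<open>In the following, \<open>w\<close> is the unit vector orthogonal to \<open>x\<close> in the direction of \<open>y\<close>.\<close>

lemma geodesic_frame:
  fixes x y :: "real ^ 'n"
  assumes "norm x = 1" "norm y = 1" "y \<noteq> x" "y \<noteq> - x"
  defines "\<theta> \<equiv> geodesic_dist x y" and "w \<equiv> radial_proj (y - (x \<bullet> y) *\<^sub>R x)"
  shows "0 < \<theta>" "\<theta> < pi" "norm w = 1" "x \<bullet> w = 0" "y = cos \<theta> *\<^sub>R x + sin \<theta> *\<^sub>R w"
proof -
  have xx: "x \<bullet> x = 1" and yy: "y \<bullet> y = 1" using assms by (simp_all add: norm_eq_1)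
  have "x \<bullet> y \<noteq> 1"
  proof
    assume "x \<bullet> y = 1"
    then have "(y - x) \<bullet> (y - x) = 0" by (simp add: inner_diff inner_commute xx yy)
    with assms show False by simp
  qed
  moreover have "x \<bullet> y \<noteq> -1"
  proof
    assume "x \<bullet> y = -1"
    then have "(y + x) \<bullet> (y + x) = 0" by (simp add: inner_add inner_commute xx yy)
    with assms show False by (simp add: eq_neg_iff_add_eq_0)
  qed
  moreover have "\<bar>x \<bullet> y\<bar> \<le> 1" using Cauchy_Schwarz_ineq2[of x y] assms by simp
  ultimately have c: "-1 < x \<bullet> y" "x \<bullet> y < 1" by auto
  show "0 < \<theta>" "\<theta> < pi"
    unfolding \<theta>_def geodesic_dist_def using arccos_lt_bounded[OF c] by auto
  have cos: "cos \<theta> = x \<bullet> y" using c by (simp add: \<theta>_def geodesic_dist_def)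
  let ?z = "y - (x \<bullet> y) *\<^sub>R x"
  have zz: "?z \<bullet> ?z = 1 - (x \<bullet> y)\<^sup>2"
    by (simp add: inner_diff xx yy inner_commute power2_eq_square)
  have nz: "norm ?z = sin \<theta>"
    using c by (simp add: norm_eq_sqrt_inner zz \<theta>_def geodesic_dist_def sin_arccos)
  have "sin \<theta> > 0" using \<open>0 < \<theta>\<close> \<open>\<theta> < pi\<close> by (rule sin_gt_zero)
  then have z0: "?z \<noteq> 0" using nz by auto
  show "norm w = 1" unfolding w_def using z0 by (rule norm_radial_proj)
  show "x \<bullet> w = 0" by (simp add: w_def radial_proj_def inner_diff xx)
  show "y = cos \<theta> *\<^sub>R x + sin \<theta> *\<^sub>R w"
    using \<open>sin \<theta> > 0\<close> by (simp add: w_def radial_proj_def nz cos)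
qed

lemma geodesic_arc_endpoints:
  fixes x y :: "real ^ 'n"
  assumes "norm x = 1" "norm y = 1" "y \<noteq> x" "y \<noteq> - x"
  shows "geodesic_arc x y 0 = x" "geodesic_arc x y (geodesic_dist x y) = y"
  using geodesic_frame(5)[OF assms] by (simp_all add: geodesic_arc_def)

lemma geodesic_arc_on_sphere:
  fixes x y :: "real ^ 'n"
  assumes "norm x = 1" "norm y = 1" "y \<noteq> x" "y \<noteq> - x"
  shows "norm (geodesic_arc x y s) = 1"
proof -
  define w where "w = radial_proj (y - (x \<bullet> y) *\<^sub>R x)"
  have "w \<bullet> w = 1" "x \<bullet> w = 0" "x \<bullet> x = 1"
    using geodesic_frame(3,4)[OF assms] assms by (auto simp: w_def norm_eq_1)
  then show ?thesis
    by (simp add: geodesic_arc_def flip: w_def)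
      (simp add: norm_eq_1 inner_add inner_commute flip: power2_eq_square)
qed

lemma geodesic_arc_unit_speed:
  fixes x y :: "real ^ 'n"
  assumes "norm x = 1" "norm y = 1" "y \<noteq> x" "y \<noteq> - x"
  shows "\<exists>v. (geodesic_arc x y has_vector_derivative v) (at s) \<and> norm v = 1"
proof -
  define w where "w = radial_proj (y - (x \<bullet> y) *\<^sub>R x)"
  have w: "w \<bullet> w = 1" "x \<bullet> w = 0" "x \<bullet> x = 1"
    using geodesic_frame(3,4)[OF assms] assms by (auto simp: w_def norm_eq_1)
  have "((\<lambda>s. cos s *\<^sub>R x + sin s *\<^sub>R w) has_vector_derivative (- sin s) *\<^sub>R x + cos s *\<^sub>R w) (at s)"
    by (auto intro!: derivative_eq_intros)
  moreover have "norm ((- sin s) *\<^sub>R x + cos s *\<^sub>R w) = 1"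
    using w by (simp add: norm_eq_1 inner_diff inner_add inner_commute flip: power2_eq_square)
  ultimately show ?thesis
    unfolding geodesic_arc_def w_def by blast
qed

lemma radial_proj_scale: "c > 0 \<Longrightarrow> radial_proj (c *\<^sub>R x) = radial_proj x"
  by (simp add: radial_proj_def)

text \<open>The radial projection of a segment is the geodesic arc between the projected endpoints.
  Hence the projection of an Euler cycle is described by the list of its projected vertices.\<close>

lemma radial_proj_closed_segment:
  fixes u v :: "real ^ 'n"
  assumes "u \<noteq> 0" "v \<noteq> 0"
  defines "x \<equiv> radial_proj u" and "y \<equiv> radial_proj v"
  assumes ne: "y \<noteq> x" "y \<noteq> - x"
  shows "radial_proj ` closed_segment u v = geodesic_arc x y ` {0..geodesic_dist x y}"
proof -
  define \<theta> where "\<theta> = geodesic_dist x y"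
  define w where "w = radial_proj (y - (x \<bullet> y) *\<^sub>R x)"
  have n: "norm x = 1" "norm y = 1" using assms by (auto simp: norm_radial_proj)
  note fr = geodesic_frame[OF n ne, folded \<theta>_def w_def]
  have w: "w \<bullet> w = 1" "x \<bullet> w = 0" "x \<bullet> x = 1" using fr n by (auto simp: norm_eq_1)
  have st: "sin \<theta> > 0" using fr by (intro sin_gt_zero)
  have ux: "u = norm u *\<^sub>R x" and vy: "v = norm v *\<^sub>R y"
    using assms by (simp_all add: radial_proj_def)
  have xu: "x = inverse (norm u) *\<^sub>R u" and yv: "y = inverse (norm v) *\<^sub>R v"
    by (simp_all add: x_def y_def radial_proj_def)
  have xd: "(c / norm u) *\<^sub>R u = c *\<^sub>R x" and yd: "(c / norm v) *\<^sub>R v = c *\<^sub>R y" for c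
    unfolding xu yv by (simp_all add: divide_inverse)
  have arc: "geodesic_arc x y s = cos s *\<^sub>R x + sin s *\<^sub>R w" for s
    by (simp add: geodesic_arc_def w_def)
  have comb: "sin \<theta> *\<^sub>R geodesic_arc x y s = sin (\<theta> - s) *\<^sub>R x + sin s *\<^sub>R y" for s
    unfolding arc by (subst fr(5)) (simp add: sin_diff algebra_simps)
  show ?thesis unfolding \<theta>_def[symmetric]
  proof (intro equalityI subsetI)
    fix z assume "z \<in> geodesic_arc x y ` {0..\<theta>}"
    then obtain s where s: "0 \<le> s" "s \<le> \<theta>" "z = geodesic_arc x y s" by auto
    define a where "a = sin (\<theta> - s) / norm u"
    define b where "b = sin s / norm v"
    have a0: "a \<ge> 0" and b0: "b \<ge> 0"
      unfolding a_def b_def using s fr by (auto intro!: divide_nonneg_nonneg sin_ge_zero)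
    have zz: "sin \<theta> *\<^sub>R z = a *\<^sub>R u + b *\<^sub>R v"
      unfolding s(3) comb a_def b_def xd yd ..
    have nz: "norm z = 1" using geodesic_arc_on_sphere[OF n ne] s by simp
    have "a + b \<noteq> 0"
    proof
      assume "a + b = 0"
      with a0 b0 have "a = 0" "b = 0" by auto
      with zz st nz show False by auto
    qed
    with a0 b0 have ab: "a + b > 0" by simp
    define q where "q = (a / (a + b)) *\<^sub>R u + (b / (a + b)) *\<^sub>R v"
    have q: "q \<in> closed_segment u v"
      unfolding in_segment q_def
      using ab a0 b0 by (intro exI[of _ "b / (a + b)"]) (auto simp: field_simps)
    have "sin \<theta> *\<^sub>R z = (a + b) *\<^sub>R q" unfolding zz q_def using ab by (simp add: scaleR_add_right)
    then have "radial_proj z = radial_proj q"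
      using radial_proj_scale[OF st, of z] radial_proj_scale[OF ab, of q] by simp
    then have "z = radial_proj q" using nz by (simp add: radial_proj_def)
    with q show "z \<in> radial_proj ` closed_segment u v" by blast
  next
    fix z assume "z \<in> radial_proj ` closed_segment u v"
    then obtain \<tau> where t: "0 \<le> \<tau>" "\<tau> \<le> 1" "z = radial_proj ((1 - \<tau>) *\<^sub>R u + \<tau> *\<^sub>R v)"
      by (auto simp: in_segment)
    define a where "a = (1 - \<tau>) * norm u"
    define b where "b = \<tau> * norm v"
    have a0: "a \<ge> 0" and b0: "b \<ge> 0" using t by (auto simp: a_def b_def)
    have nab: "\<not> (a = 0 \<and> b = 0)" using assms t by (auto simp: a_def b_def)
    define q where "q = (1 - \<tau>) *\<^sub>R u + \<tau> *\<^sub>R v"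
    have "q = a *\<^sub>R x + b *\<^sub>R y"
      unfolding q_def a_def b_def by (subst ux, subst vy) simp
    then have q: "q = (a + b * cos \<theta>) *\<^sub>R x + (b * sin \<theta>) *\<^sub>R w"
      by (subst (asm) fr(5)) (simp add: algebra_simps)
    have qq: "q \<bullet> q = (a + b * cos \<theta>)\<^sup>2 + (b * sin \<theta>)\<^sup>2"
      unfolding q using w by (simp add: inner_add inner_commute power2_eq_square algebra_simps)
    define r where "r = norm q"
    have r2: "r\<^sup>2 = (a + b * cos \<theta>)\<^sup>2 + (b * sin \<theta>)\<^sup>2"
      unfolding r_def by (simp add: qq flip: dot_square_norm)
    have "r \<noteq> 0"
    proof
      assume "r = 0"
      with r2 have "a + b * cos \<theta> = 0" "b * sin \<theta> = 0"
        by (auto simp: sum_power2_eq_zero_iff)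
      with st nab show False by auto
    qed
    then have r: "r > 0" by (simp add: r_def)
    have "((a + b * cos \<theta>) / r)\<^sup>2 + (b * sin \<theta> / r)\<^sup>2 = 1"
      unfolding power_divide add_divide_distrib[symmetric] r2[symmetric] using r by simp
    moreover have "0 \<le> b * sin \<theta> / r" using b0 st r by simp
    ultimately obtain s where s: "0 \<le> s" "s \<le> pi" "(a + b * cos \<theta>) / r = cos s" "b * sin \<theta> / r = sin s"
      using sincos_total_pi by metis
    have "s \<le> \<theta>"
    proof (rule ccontr)
      assume "\<not> s \<le> \<theta>"
      then have "sin (s - \<theta>) > 0" using s fr by (intro sin_gt_zero) auto
      moreover have "sin (s - \<theta>) = - (a * sin \<theta> / r)"
        using r by (simp add: sin_diff flip: s) (simp add: field_simps)
      moreover have "a * sin \<theta> / r \<ge> 0" using a0 st r by simp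
      ultimately show False by simp
    qed
    have "z = q /\<^sub>R r" using t by (simp add: q_def r_def radial_proj_def)
    also have "\<dots> = geodesic_arc x y s"
      unfolding arc s(3,4)[symmetric] by (subst q) (simp add: scaleR_add_right divide_inverse mult.commute)
    finally show "z \<in> geodesic_arc x y ` {0..\<theta>}"
      using s \<open>s \<le> \<theta>\<close> by auto
  qed
qed

end

theory Submission
  imports Defs
begin

text \<open>Write \<open>G\<close> for the symmetry group of \<open>P\<close>, \<open>S\<close> for the spherical mean of \<open>p\<close>, and \<open>J p e\<close> for the
  arc-length integral of \<open>p\<close> over the radial projection of the edge \<open>e\<close>. An Euler cycle traverses
  every edge once, and \<open>J p e\<close> does not depend on the direction of travel, so the integral of \<open>p\<close>
  over the projected cycle is the sum of \<open>J p e\<close> over all edges \<open>e\<close>.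

  The group permutes the edges, so replacing \<open>e\<close> by \<open>g ` e\<close> does not change this sum, and
  \<open>J p (g ` e) = J (p \<circ> g) e\<close> because orthogonal maps carry geodesic arcs to geodesic arcs. Summing
  over \<open>g\<close> as well, \<open>card G\<close> times the integral over the cycle is the sum over \<open>e\<close> of
  \<open>J (\<Sum>g\<in>G. p \<circ> g) e\<close>. By homogeneity the function \<open>\<Sum>g\<in>G. p \<circ> g\<close> is constant on the sphere, with
  value \<open>card G * S\<close>: its value at \<open>x\<close> is the sum of \<open>p\<close> over the orbit of \<open>x\<close>, with all points counted
  equally often (\<open>homogeneous_average\<close>). So the integral over each single edge, averaged over \<open>G\<close>, is
  already \<open>S\<close> times the length of its arc (\<open>average_arc_integral\<close>), and the claim follows by adding
  these equations and dividing by the total length.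

  This needs the edges to project to proper arcs, which holds because the origin is an interior
  point (\<open>edge_projection_nondegenerate\<close>).\<close>

section \<open>Averages over a homogeneous group\<close>

lemma continuous_on_Pol_le:
  assumes "p \<in> Pol_le t"
  shows "continuous_on A p"
  using assms by (auto simp: Pol_le_def intro!: continuous_intros)

text \<open>All fibres of \<open>g \<mapsto> g x\<close> are left cosets of the stabilizer of \<open>x\<close>, hence equally large.\<close>

lemma card_orbit_fibre:
  fixes G :: "(real ^ 'n \<Rightarrow> real ^ 'n) set"
  assumes G: "subgroup G orthogonal_group" and h: "h \<in> G"
  shows "card {g \<in> G. g x = h x} = card {g \<in> G. g x = x}"
proof -
  interpret O: Group.group "orthogonal_group :: (real ^ 'n \<Rightarrow> real ^ 'n) monoid"
    by (rule group_orthogonal_group)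
  have mult: "f \<otimes>\<^bsub>orthogonal_group\<^esub> g = f \<circ> g" for f g :: "real ^ 'n \<Rightarrow> real ^ 'n"
    by (simp add: orthogonal_group_def)
  have hc: "h \<in> carrier orthogonal_group" using subgroup.subset[OF G] h by auto
  define k where "k = inv\<^bsub>orthogonal_group\<^esub> h"
  have k: "k \<in> G" unfolding k_def using G h by (rule subgroup.m_inv_closed)
  have hk: "h \<circ> k = id" and kh: "k \<circ> h = id"
    using O.r_inv[OF hc] O.l_inv[OF hc] by (simp_all add: mult k_def) (simp_all add: orthogonal_group_def)
  have closed: "f \<circ> g \<in> G" if "f \<in> G" "g \<in> G" for f g
    using subgroup.m_closed[OF G that] by (simp add: mult)
  have "bij_betw ((\<circ>) k) {g \<in> G. g x = h x} {g \<in> G. g x = x}"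
  proof (rule bij_betwI[where g = "(\<circ>) h"])
    show "(\<circ>) k \<in> {g \<in> G. g x = h x} \<rightarrow> {g \<in> G. g x = x}"
      using closed k fun_cong[OF kh, of x] by auto
    show "(\<circ>) h \<in> {g \<in> G. g x = x} \<rightarrow> {g \<in> G. g x = h x}"
      using closed h by auto
    show "h \<circ> (k \<circ> f) = f" "k \<circ> (h \<circ> f) = f" for f
      using hk kh by (simp_all add: comp_assoc[symmetric])
  qed
  then show ?thesis by (rule bij_betw_same_card)
qed

lemma homogeneous_average:
  fixes G :: "(real ^ 'n \<Rightarrow> real ^ 'n) set"
  assumes hom: "homogeneous t G" and x: "x \<in> sphere 0 1" and p: "p \<in> Pol_le t"
  shows "(\<Sum>g\<in>G. p (g x)) = card G * sphere_integral p"
proof -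
  define X where "X = {g x | g. g \<in> G}"
  define m where "m = card {g \<in> G. g x = x}"
  have fin: "finite G" and sub: "subgroup G orthogonal_group"
    and des: "spherical_design t X"
    using hom x by (auto simp: homogeneous_def X_def)
  have X: "finite X" "X \<noteq> {}" using des by (auto simp: spherical_design_def)
  have sum: "(\<Sum>g\<in>G. f (g x)) = m * (\<Sum>y\<in>X. f y)" for f :: "real ^ 'n \<Rightarrow> real"
  proof -
    have "(\<Sum>g\<in>G. f (g x)) = (\<Sum>y\<in>X. \<Sum>g\<in>{g \<in> G. g x = y}. f (g x))"
      by (rule sum.group[symmetric]) (use fin X in \<open>auto simp: X_def\<close>)
    also have "\<dots> = (\<Sum>y\<in>X. m * f y)"
    proof (rule sum.cong[OF refl])
      fix y assume "y \<in> X"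
      then obtain h where "h \<in> G" "y = h x" by (auto simp: X_def)
      then show "(\<Sum>g\<in>{g \<in> G. g x = y}. f (g x)) = m * f y"
        using card_orbit_fibre[OF sub, of h x] by (simp add: m_def)
    qed
    finally show ?thesis by (simp add: sum_distrib_left)
  qed
  have "real (card G) = m * card X" using sum[of "\<lambda>_. 1"] by simp
  moreover have "(\<Sum>y\<in>X. p y) = card X * sphere_integral p"
    using des p X by (auto simp: spherical_design_def field_simps)
  ultimately show ?thesis using sum[of p] by simp
qed

section \<open>Integrals over geodesic arcs\<close>

definition arc_integral :: "(real ^ 'n \<Rightarrow> real) \<Rightarrow> real ^ 'n \<Rightarrow> real ^ 'n \<Rightarrow> real" where
  "arc_integral p x y = integral {0..geodesic_dist x y} (\<lambda>s. p (geodesic_arc x y s))"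

lemma arc_integral_orthogonal:
  assumes g: "orthogonal_transformation g"
  shows "arc_integral p (g x) (g y) = arc_integral (p \<circ> g) x y"
proof -
  have lin: "linear g" using g by (rule orthogonal_transformation_linear)
  have ip: "g u \<bullet> g v = u \<bullet> v" for u v
    using g by (simp add: orthogonal_transformation_def)
  have "geodesic_arc (g x) (g y) s = g (geodesic_arc x y s)" for s
    unfolding geodesic_arc_def
    by (simp add: ip linear_add[OF lin] linear_scale[OF lin] linear_diff[OF lin]
        flip: radial_proj_orthogonal[OF g])
  then show ?thesis by (simp add: arc_integral_def geodesic_dist_def ip)
qed

text \<open>Spherical linear interpolation: in this form the arc is visibly symmetric in its endpoints.\<close>

lemma geodesic_arc_slerp:
  fixes x y :: "real ^ 'n"
  assumes "norm x = 1" "norm y = 1" "y \<noteq> x" "y \<noteq> - x"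
  defines "\<theta> \<equiv> geodesic_dist x y"
  shows "sin \<theta> *\<^sub>R geodesic_arc x y s = sin (\<theta> - s) *\<^sub>R x + sin s *\<^sub>R y"
proof -
  define w where "w = radial_proj (y - (x \<bullet> y) *\<^sub>R x)"
  have arc: "geodesic_arc x y s = cos s *\<^sub>R x + sin s *\<^sub>R w"
    by (simp add: geodesic_arc_def w_def)
  have y: "y = cos \<theta> *\<^sub>R x + sin \<theta> *\<^sub>R w"
    unfolding \<theta>_def w_def by (rule geodesic_frame(5)[OF assms(1-4)])
  have "sin (\<theta> - s) *\<^sub>R x + sin s *\<^sub>R (cos \<theta> *\<^sub>R x + sin \<theta> *\<^sub>R w)
      = sin \<theta> *\<^sub>R (cos s *\<^sub>R x + sin s *\<^sub>R w)"
    by (simp add: sin_diff algebra_simps)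
  then show ?thesis
    by (simp only: arc flip: y)
qed

lemma arc_integral_reverse:
  fixes x y :: "real ^ 'n"
  assumes "norm x = 1" "norm y = 1" "y \<noteq> x" "y \<noteq> - x"
  shows "arc_integral p y x = arc_integral p x y"
proof -
  define \<theta> where "\<theta> = geodesic_dist x y"
  have \<theta>': "geodesic_dist y x = \<theta>" by (simp add: \<theta>_def geodesic_dist_def inner_commute)
  have "sin \<theta> > 0"
    using geodesic_frame(1,2)[OF assms] unfolding \<theta>_def by (rule sin_gt_zero)
  have "x \<noteq> y" "x \<noteq> - y" using assms by auto
  have "sin \<theta> *\<^sub>R geodesic_arc y x s = sin \<theta> *\<^sub>R geodesic_arc x y (\<theta> - s)" for s
    using geodesic_arc_slerp[OF assms, of "\<theta> - s"]
      geodesic_arc_slerp[OF assms(2,1) \<open>x \<noteq> y\<close> \<open>x \<noteq> - y\<close>, of s]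
    by (simp add: \<theta>' flip: \<theta>_def)
  then have rev: "geodesic_arc y x s = geodesic_arc x y (\<theta> - s)" for s
    using \<open>sin \<theta> > 0\<close> by simp
  let ?f = "\<lambda>s. p (geodesic_arc x y s)"
  have "integral {0..\<theta>} (\<lambda>s. ?f (\<theta> - s)) = integral {-\<theta>..0} (\<lambda>s. ?f (\<theta> + s))"
    using Henstock_Kurzweil_Integration.integral_reflect_real[of "\<theta>" 0 "\<lambda>s. ?f (\<theta> - s)"] by simp
  also have "\<dots> = integral {0..\<theta>} ?f"
    using integral_shift_Icc_real[of "-\<theta>" 0 ?f \<theta>] by (simp add: o_def)
  finally show ?thesis by (simp add: arc_integral_def \<theta>' rev flip: \<theta>_def)
qed

text \<open>The arc itself carries no design property; its \<open>G\<close>-translates together do, because every point of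
  the arc has a design as its orbit and the finite sum over \<open>G\<close> can be taken under the integral.\<close>

lemma average_arc_integral:
  fixes x y :: "real ^ 'n"
  assumes hom: "homogeneous t G" and p: "p \<in> Pol_le t"
    and xy: "norm x = 1" "norm y = 1" "y \<noteq> x" "y \<noteq> - x"
  shows "(\<Sum>g\<in>G. arc_integral (p \<circ> g) x y) = card G * sphere_integral p * geodesic_dist x y"
proof -
  let ?I = "{0..geodesic_dist x y}"
  have orth: "orthogonal_transformation g" if "g \<in> G" for g
    using hom that subgroup.subset[of G orthogonal_group]
    by (auto simp: homogeneous_def orthogonal_group_def)
  have "(\<lambda>s. p (g (geodesic_arc x y s))) integrable_on ?I" if "g \<in> G" for g
  proof (rule integrable_continuous_real)
    have "continuous_on UNIV g"
      using orthogonal_transformation_linear[OF orth[OF that]]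
      by (intro linear_continuous_on) (simp add: linear_conv_bounded_linear)
    moreover have "continuous_on ?I (geodesic_arc x y)"
      unfolding geodesic_arc_def by (intro continuous_intros)
    ultimately have "continuous_on ?I (\<lambda>s. g (geodesic_arc x y s))"
      by (rule continuous_on_compose2) simp
    then show "continuous_on ?I (\<lambda>s. p (g (geodesic_arc x y s)))"
      by (rule continuous_on_compose2[OF continuous_on_Pol_le[OF p, of UNIV]]) simp
  qed
  moreover have "finite G" using hom by (simp add: homogeneous_def)
  ultimately have "(\<Sum>g\<in>G. arc_integral (p \<circ> g) x y)
      = integral ?I (\<lambda>s. \<Sum>g\<in>G. p (g (geodesic_arc x y s)))"
    by (simp add: arc_integral_def o_def integral_sum)
  also have "\<dots> = integral ?I (\<lambda>s. card G * sphere_integral p)"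
    using geodesic_arc_on_sphere[OF xy] by (simp add: homogeneous_average[OF hom _ p])
  also have "\<dots> = card G * sphere_integral p * geodesic_dist x y"
    using geodesic_frame(1)[OF xy] by simp
  finally show ?thesis .
qed

section \<open>Edges and their projections\<close>

text \<open>An edge does not meet the interior of the polytope, so it misses the origin and its endpoints
  cannot project to antipodal points. If they projected to the same point, the endpoint closer to
  the origin would lie strictly between the origin and the other one, hence in the interior.\<close>

lemma edge_projection_nondegenerate:
  fixes P :: "(real ^ 'n) set"
  assumes P: "convex P" "0 \<in> interior P" and n: "CARD('n) \<ge> 2"
    and edge: "closed_segment u v edge_of P"
  shows "u \<noteq> 0" "v \<noteq> 0" "radial_proj v \<noteq> radial_proj u" "radial_proj v \<noteq> - radial_proj u"
proof -
  have face: "closed_segment u v face_of P" and dim: "aff_dim (closed_segment u v) = 1"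
    using edge by (auto simp: edge_of_def)
  have "u \<noteq> v" using dim by auto
  have "aff_dim P = CARD('n)" using P by (subst aff_dim_nonempty_interior) auto
  then have "closed_segment u v \<noteq> P" using dim n by auto
  then have disj: "closed_segment u v \<inter> interior P = {}"
    using face by (intro face_of_disjoint_interior)
  then have 0: "0 \<notin> closed_segment u v" using P by auto
  then show "u \<noteq> 0" "v \<noteq> 0" by auto
  have sub: "closed_segment u v \<subseteq> P" using face by (rule face_of_imp_subset)
  have notin: False if ab: "{a, b} = {u, v}" and s: "0 < s" "s < 1" "a = s *\<^sub>R b" for a b s
  proof -
    have "a \<in> closed_segment u v" "b \<in> P" "b \<noteq> 0" using ab sub 0 by (auto simp: doubleton_eq_iff)
    moreover from \<open>b \<noteq> 0\<close> s have "a \<in> open_segment 0 b" by (auto simp: in_segment)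
    ultimately show False
      using in_interior_closure_convex_segment[OF P, of b] closure_subset[of P] disj by auto
  qed
  show "radial_proj v \<noteq> radial_proj u"
  proof
    assume "radial_proj v = radial_proj u"
    then have eq: "v /\<^sub>R norm v = u /\<^sub>R norm u" by (simp add: radial_proj_def)
    define s where "s = norm u / norm v"
    have "s > 0" using \<open>u \<noteq> 0\<close> \<open>v \<noteq> 0\<close> by (simp add: s_def)
    have "u = norm u *\<^sub>R (u /\<^sub>R norm u)" using \<open>u \<noteq> 0\<close> by simp
    then have u: "u = s *\<^sub>R v" unfolding eq[symmetric] by (simp add: s_def divide_inverse)
    then have v: "v = (1 / s) *\<^sub>R u" using \<open>s > 0\<close> by simp
    have "s \<noteq> 1" using u \<open>u \<noteq> v\<close> by auto
    then have "s < 1 \<or> 1 / s < 1" using \<open>s > 0\<close> by auto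
    then show False
    proof
      assume "s < 1"
      then show False using notin[OF _ \<open>s > 0\<close> _ u] by simp
    next
      assume "1 / s < 1"
      then show False using notin[OF _ _ _ v] \<open>s > 0\<close> by (simp add: insert_commute)
    qed
  qed
  show "radial_proj v \<noteq> - radial_proj u"
  proof
    assume "radial_proj v = - radial_proj u"
    moreover have "norm u *\<^sub>R v + norm v *\<^sub>R u = (norm u * norm v) *\<^sub>R (radial_proj v + radial_proj u)"
      using \<open>u \<noteq> 0\<close> \<open>v \<noteq> 0\<close> by (simp add: radial_proj_def scaleR_add_right flip: divide_inverse)
    ultimately have eq: "norm u *\<^sub>R v + norm v *\<^sub>R u = 0" by simp
    \<comment> \<open>The vanishing positive combination of \<open>u\<close> and \<open>v\<close>, normalized, puts \<open>0\<close> on the segment.\<close>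
    define \<tau> where "\<tau> = norm u / (norm u + norm v)"
    have pos: "norm u + norm v > 0" using \<open>u \<noteq> 0\<close> by (simp add: add_pos_nonneg)
    have "1 - \<tau> = norm v / (norm u + norm v)" using pos by (simp add: \<tau>_def field_simps)
    then have "(1 - \<tau>) *\<^sub>R u + \<tau> *\<^sub>R v = (norm u *\<^sub>R v + norm v *\<^sub>R u) /\<^sub>R (norm u + norm v)"
      by (simp add: \<tau>_def divide_inverse scaleR_add_right mult.commute)
    then have "(1 - \<tau>) *\<^sub>R u + \<tau> *\<^sub>R v = 0" using eq by simp
    moreover have "0 \<le> \<tau>" "\<tau> \<le> 1" using pos by (simp_all add: \<tau>_def)
    ultimately show False using 0 by (auto simp: in_segment)
  qed
qed

text \<open>The endpoints of a segment are determined only up to order; by \<open>arc_integral_reverse\<close> the choice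
  is immaterial.\<close>

definition edge_integral :: "(real ^ 'n \<Rightarrow> real) \<Rightarrow> (real ^ 'n) set \<Rightarrow> real" where
  "edge_integral p e =
     (let (u, v) = SOME (u, v). e = closed_segment u v in arc_integral p (radial_proj u) (radial_proj v))"

lemma edge_integral_closed_segment:
  assumes "u \<noteq> 0" "v \<noteq> 0" "radial_proj v \<noteq> radial_proj u" "radial_proj v \<noteq> - radial_proj u"
  shows "edge_integral p (closed_segment u v) = arc_integral p (radial_proj u) (radial_proj v)"
proof -
  obtain a b where ab: "(SOME (a, b). closed_segment u v = closed_segment a b) = (a, b)"
    by fastforce
  have "case (SOME (a, b). closed_segment u v = closed_segment a b) of
      (a, b) \<Rightarrow> closed_segment u v = closed_segment a b"
    by (rule someI[of _ "(u, v)"]) simp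
  then have "closed_segment u v = closed_segment a b" unfolding ab by (simp only: prod.case)
  then have "a = u \<and> b = v \<or> a = v \<and> b = u" by (auto simp: doubleton_eq_iff)
  then show ?thesis
    using arc_integral_reverse[of "radial_proj u" "radial_proj v" p] assms
    unfolding edge_integral_def ab by (auto simp: norm_radial_proj)
qed

lemma edge_of_orthogonal_image:
  fixes P :: "(real ^ 'n) set"
  assumes g: "orthogonal_transformation g" and "g ` P = P" and "e edge_of P"
  shows "g ` e edge_of P"
  using assms face_of_linear_image[of g e P] aff_dim_injective_linear_image[of g e]
  by (simp add: edge_of_def orthogonal_transformation_linear orthogonal_transformation_inj)

text \<open>Distinct edges have distinct images; since there are finitely many edges, every edge is an image.\<close>

lemma symmetry_permutes_edges:
  fixes P :: "(real ^ 'n) set"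
  assumes g: "orthogonal_transformation g" and P: "g ` P = P" and fin: "finite {e. e edge_of P}"
  shows "bij_betw ((`) g) {e. e edge_of P} {e. e edge_of P}"
proof -
  have "inj_on ((`) g) {e. e edge_of P}"
    using orthogonal_transformation_inj[OF g] by (auto intro!: inj_onI simp: inj_image_eq_iff)
  moreover have "(`) g ` {e. e edge_of P} \<subseteq> {e. e edge_of P}"
    using edge_of_orthogonal_image[OF g P] by auto
  ultimately show ?thesis
    using endo_inj_surj[OF fin] by (auto simp: bij_betw_def)
qed

lemma cycle_integral_radial_proj:
  "cycle_integral (map radial_proj vs) p =
     (\<Sum>(u, v)\<leftarrow>cyclic_pairs vs. arc_integral p (radial_proj u) (radial_proj v))"
  by (simp add: cycle_integral_def cyclic_pairs_def rotate1_map zip_map_map arc_integral_def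
      case_prod_unfold o_def)

section \<open>Euler cycles are design cycles\<close>

theorem theorem3p1:
  fixes d t :: nat and P :: "(real ^ 'n) set"
  assumes "d \<ge> 1" and "CARD('n) = d + 1"
    and "polytope P" and "aff_dim P = int (d + 1)" and "0 \<in> interior P"
    and "edge_transitive P"
    and "homogeneous t (symmetry_group P)"
  shows "\<forall>vs. euler_cycle P vs \<longrightarrow> spherical_design_cycle t (map radial_proj vs)"
proof (intro allI impI)
  fix vs assume euler: "euler_cycle P vs"
  define G where "G = symmetry_group P"
  define E where "E = {e. e edge_of P}"
  define seg where "seg = (\<lambda>(u, v). closed_segment u v :: (real ^ 'n) set)"
  have hom: "homogeneous t G" using assms by (simp add: G_def)
  have vs: "vs \<noteq> []" and dist: "distinct (map seg (cyclic_pairs vs))"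
    and edges: "set (map seg (cyclic_pairs vs)) = E"
    and extr: "\<And>v. v \<in> set vs \<Longrightarrow> v extreme_point_of P"
    using euler unfolding euler_cycle_def Let_def seg_def E_def by auto
  have fin: "finite E" unfolding edges[symmetric] by simp
  have nondeg: "u \<noteq> 0 \<and> v \<noteq> 0 \<and> radial_proj v \<noteq> radial_proj u \<and> radial_proj v \<noteq> - radial_proj u"
    if "closed_segment u v \<in> E" for u v
    using edge_projection_nondegenerate[of P u v] assms that polytope_imp_convex[of P]
    by (auto simp: E_def)
  have pairE: "closed_segment u v \<in> E" if "(u, v) \<in> set (cyclic_pairs vs)" for u v
    using that unfolding edges[symmetric] by (force simp: seg_def)
  have E_seg: "\<exists>u v. e = closed_segment u v" if "e \<in> E" for e
    using that unfolding edges[symmetric] by (auto simp: seg_def)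
  have J: "edge_integral p (closed_segment u v) = arc_integral p (radial_proj u) (radial_proj v)"
    if "closed_segment u v \<in> E" for p u v
    using nondeg[OF that] by (intro edge_integral_closed_segment) auto
  have "set (map radial_proj vs) \<subseteq> sphere 0 1"
    using extr extreme_point_not_in_interior[of _ P] \<open>0 \<in> interior P\<close>
    by (auto intro!: norm_radial_proj)
  then have cycle: "geodesic_cycle (map radial_proj vs)"
    using vs nondeg[OF pairE]
    by (auto simp: geodesic_cycle_def cyclic_pairs_def rotate1_map zip_map_map)
  have cyc_int: "cycle_integral (map radial_proj vs) p = (\<Sum>e\<in>E. edge_integral p e)" for p
  proof -
    have "cycle_integral (map radial_proj vs) p
        = sum_list (map (edge_integral p) (map seg (cyclic_pairs vs)))"
      unfolding cycle_integral_radial_proj map_map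
      using J[OF pairE] by (intro arg_cong[of _ _ sum_list] map_cong) (auto simp: seg_def)
    also have "\<dots> = (\<Sum>e\<in>E. edge_integral p e)"
      by (simp only: sum_list_distinct_conv_sum_set[OF dist] edges)
    finally show ?thesis .
  qed
  have sym: "orthogonal_transformation g" "g ` P = P" if "g \<in> G" for g
    using that by (auto simp: G_def symmetry_group_def orthogonal_group_def)
  have equivariant: "edge_integral p (g ` e) = edge_integral (p \<circ> g) e" if "g \<in> G" "e \<in> E" for g e p
  proof -
    note g = sym[OF \<open>g \<in> G\<close>]
    obtain u v where e: "e = closed_segment u v" using E_seg[OF \<open>e \<in> E\<close>] by auto
    have ge: "g ` e = closed_segment (g u) (g v)"
      unfolding e by (simp add: closed_segment_linear_image orthogonal_transformation_linear g)
    have "g ` e \<in> E" using edge_of_orthogonal_image[OF g] \<open>e \<in> E\<close> by (simp add: E_def)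
    then show ?thesis
      using \<open>e \<in> E\<close> by (simp add: ge J radial_proj_orthogonal g arc_integral_orthogonal) (simp add: e J)
  qed
  have length_pos: "edge_integral (\<lambda>_. 1) e > 0"
    and average: "p \<in> Pol_le t \<Longrightarrow>
      (\<Sum>g\<in>G. edge_integral (p \<circ> g) e) = card G * sphere_integral p * edge_integral (\<lambda>_. 1) e"
    if "e \<in> E" for e p
  proof -
    obtain u v where e: "e = closed_segment u v" using E_seg[OF \<open>e \<in> E\<close>] by auto
    note uv = nondeg[OF that[unfolded e]]
    have n: "norm (radial_proj u) = 1" "norm (radial_proj v) = 1"
      using uv by (auto intro: norm_radial_proj)
    have pos: "geodesic_dist (radial_proj u) (radial_proj v) > 0"
      using geodesic_frame(1)[OF n] uv by auto
    have len: "edge_integral (\<lambda>_. 1) e = geodesic_dist (radial_proj u) (radial_proj v)"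
      using J[OF that[unfolded e]] pos by (simp add: e arc_integral_def)
    show "edge_integral (\<lambda>_. 1) e > 0" using pos len by simp
    show "(\<Sum>g\<in>G. edge_integral (p \<circ> g) e) = card G * sphere_integral p * edge_integral (\<lambda>_. 1) e"
      if "p \<in> Pol_le t"
      unfolding len using average_arc_integral[OF hom that n] uv J[OF \<open>e \<in> E\<close>[unfolded e]]
      by (simp add: e)
  qed
  have "finite G" "G \<noteq> {}"
    using hom subgroup.one_closed[of G orthogonal_group] by (auto simp: homogeneous_def)
  then have cardG: "card G > 0" by (simp add: card_gt_0_iff)
  have "cycle_integral (map radial_proj vs) p / cycle_length (map radial_proj vs) = sphere_integral p"
    if p: "p \<in> Pol_le t" for p
  proof -
    let ?L = "\<Sum>e\<in>E. edge_integral (\<lambda>_. 1) e"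
    \<comment> \<open>Every \<open>g\<close> contributes the same sum, reindexed by the permutation of the edges it induces.\<close>
    have "card G * (\<Sum>e\<in>E. edge_integral p e) = (\<Sum>g\<in>G. \<Sum>e\<in>E. edge_integral p (g ` e))"
      using sum.reindex_bij_betw[OF symmetry_permutes_edges[OF sym fin[unfolded E_def]],
          of _ "edge_integral p"]
      by (simp add: E_def)
    also have "\<dots> = (\<Sum>e\<in>E. \<Sum>g\<in>G. edge_integral (p \<circ> g) e)"
      by (subst sum.swap) (simp add: equivariant)
    also have "\<dots> = card G * (sphere_integral p * ?L)"
      using p by (simp add: average sum_distrib_left mult.assoc)
    finally have "(\<Sum>e\<in>E. edge_integral p e) = sphere_integral p * ?L"
      using cardG by simp
    moreover have "E \<noteq> {}"
      using vs unfolding edges[symmetric] by (cases vs) (auto simp: cyclic_pairs_def)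
    then have "?L > 0" using fin length_pos by (intro sum_pos) auto
    ultimately show ?thesis by (simp add: cycle_length_def cyc_int)
  qed
  with cycle show "spherical_design_cycle t (map radial_proj vs)"
    by (simp add: spherical_design_cycle_def)
qed

end
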